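(* Let $f(\tau)=\sum_{n\ge1}a_ne^{2\pi in\tau}$ be a nonzero holomorphic cusp form of weight $k>0$ on $SL_2(\mathbb Z)$ (in the sense of the context), and for real $x$ and $\alpha$ put $S(x,\alpha)=\sum_{n\le x}a_ne^{2\pi in\alpha}$. If $\alpha\in\mathbb Q$, then $$S(x,\alpha)=\Omega\left(x^{\frac k2-\frac14}\right)\quad\text{as }x\to+\infty.$$
   Context: Let $\Gamma=SL_2(\mathbb Z)$ and let $\mathbb H$ be the upper half plane. A holomorphic cusp form of weight $k>0$ on $\Gamma$ is a function $f$, holomorphic on $\mathbb H\cup\{\infty\}$ with $f(\infty)=0$, such that for every $\gamma=\begin{pmatrix}a&b\\c&d\end{pmatrix}\in\Gamma$ with $c>0$ there is a complex number $A(\gamma)$ of modulus $1$ with $$f\left(\frac{a\tau+b}{c\tau+d}\right)=A(\gamma)[-i(c\tau+d)]^kf(\tau)\qquad(\tau\in\mathbb H),$$ with the principal branch of the power. It is assumed that $f(\tau)=\sum_{n\ge1}a_ne^{2\pi in\tau}$ (so $f(\tau+1)=f(\tau)$) with not all $a_n$ equal to zero. $g(x)=\Omega(h(x))$ means that $g(x)=o(h(x))$ as $x\to+\infty$ is false. *)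

theory Defs
  imports "HOL-Complex_Analysis.Complex_Analysis" "HOL-Library.Landau_Symbols"
begin

definition upper_half_plane :: "complex set" where
  "upper_half_plane = {\<tau>. Im \<tau> > 0}"

text \<open>
  Holomorphy at the cusp is holomorphy at \<open>q = 0\<close> in the local coordinate
  \<open>q = exp (2 \<pi> i \<tau>)\<close>, and \<open>f(\<infinity>)\<close> is the value there; a witness \<open>g\<close> makes \<open>f\<close> 1-periodic.
  The weight may be any positive real.  The multiplier \<open>A\<close> depends on the matrix only, not
  on the point \<open>\<tau>\<close>, and \<open>powr\<close> on complex numbers uses the principal logarithm
  (its base has positive real part here, as \<open>c > 0\<close>).
\<close>
definition cusp_form :: "real \<Rightarrow> (complex \<Rightarrow> complex) \<Rightarrow> bool" where
  "cusp_form k f \<longleftrightarrow>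
     k > 0 \<and>
     f holomorphic_on upper_half_plane \<and>
     (\<exists>g. g holomorphic_on ball 0 1 \<and> g 0 = 0 \<and>
          (\<forall>\<tau>\<in>upper_half_plane. f \<tau> = g (exp (2 * of_real pi * \<i> * \<tau>)))) \<and>
     (\<forall>a b c d :: int. a * d - b * c = 1 \<and> c > 0 \<longrightarrow>
        (\<exists>A :: complex. norm A = 1 \<and>
          (\<forall>\<tau>\<in>upper_half_plane.
             f ((of_int a * \<tau> + of_int b) / (of_int c * \<tau> + of_int d)) =
               A * ((- \<i> * (of_int c * \<tau> + of_int d)) powr of_real k) * f \<tau>)))"

text \<open>The value \<open>a 0\<close> is irrelevant, here and in \<open>exp_sum\<close>.\<close>
definition fourier_expansion :: "(complex \<Rightarrow> complex) \<Rightarrow> (nat \<Rightarrow> complex) \<Rightarrow> bool" where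
  "fourier_expansion f a \<longleftrightarrow>
     (\<forall>\<tau>\<in>upper_half_plane.
        (\<lambda>n. a (Suc n) * exp (2 * of_real pi * \<i> * of_nat (Suc n) * \<tau>)) sums f \<tau>)"

definition exp_sum :: "(nat \<Rightarrow> complex) \<Rightarrow> real \<Rightarrow> real \<Rightarrow> complex" where
  "exp_sum a x \<alpha> =
     (\<Sum>n\<in>{n. 1 \<le> n \<and> real n \<le> x}. a n * exp (2 * of_real pi * \<i> * of_nat n * of_real \<alpha>))"

end

(*
  Suppose S(n) = o(n^(k/2 - 1/4)). Abel summation gives f(\<alpha> + i s) = (1 - q) * P(q) with q = exp(-2 \<pi> s) and
  P(q) = \<Sum> S(n) q^n. By Parseval on the circle |q| = exp(-2 \<pi> \<sigma>), the mean square of P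
  is \<Sum> |S(n)|^2 exp(-4 \<pi> n \<sigma>), which is o(\<sigma>^(-(k + 1/2))) as \<sigma> \<rightarrow> 0.
  On the other hand, write \<alpha> = -d/c in lowest terms. Modularity gives
  |f(\<alpha> + i s)| = |c s|^(-k) |f(a/c + i/(c^2 s))|, and along Re s = \<sigma> = y/(c^2 N^2) the argument
  a/c + i/(c^2 s) comes close to \<tau>0 + m for about N integers m, each time for s in an interval of
  length about N^(-2), where |P| is at least of order N^(k + 1) if f(\<tau>0) \<noteq> 0.
  So the mean square is at least of order N^(2 k + 1), that is, \<sigma>^(-(k + 1/2)).
*)
theory Submission
  imports Defs
begin

section \<open>Power series, Parseval's identity and Abel summation\<close>

text \<open>The binomial series of \<open>(1 - r) powr - (p + 1)\<close> has coefficients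
  \<open>pochhammer (p + 1) n / fact n\<close>, positive because \<open>p > -1\<close> and
  asymptotic to \<open>n^p / Gamma (p + 1)\<close>. Hence \<open>n^p\<close> is at most a constant
  times these coefficients, and the two series can be compared term by term.\<close>

lemma suminf_powr_mult_power_le:
  fixes p :: real
  assumes "p > -1"
  shows "\<exists>C>0. \<forall>r. 0 \<le> r \<and> r < 1 \<longrightarrow> summable (\<lambda>n. real n powr p * r ^ n) \<and>
    (\<Sum>n. real n powr p * r ^ n) \<le> C * (1 - r) powr - (p + 1)"
proof -
  define g where "g n = pochhammer (p + 1) n / fact n" for n
  have g_eq: "(- (p + 1) gchoose n) = (-1) ^ n * g n" for n
    by (simp add: gbinomial_pochhammer g_def add.commute)
  have g_pos: "g n > 0" for n
    using assms by (auto simp: g_def intro!: divide_pos_pos pochhammer_pos)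
  have "(\<lambda>n. g n * exp (- p * ln (real n))) \<longlonglongrightarrow> inverse (Gamma (p + 1))"
  proof -
    have "(- (p + 1) gchoose n) / ((-1) ^ n / exp ((- (p + 1) + 1) * of_real (ln (real n))))
        = g n * exp (- p * ln (real n))" for n
      unfolding g_eq by simp
    then show ?thesis
      using gbinomial_asymptotic[of "- (p + 1)"] by (simp add: add.commute)
  qed
  \<comment> \<open>A nonzero limit allows passing to reciprocals; these converge, so they are
    bounded, and the bound is \<open>C\<close>.\<close>
  moreover have "Gamma (p + 1) > 0"
    using assms by (intro Gamma_real_pos) simp
  ultimately have "(\<lambda>n. inverse (g n * exp (- p * ln (real n)))) \<longlonglongrightarrow> Gamma (p + 1)"
    using tendsto_inverse by fastforce
  then have "Bseq (\<lambda>n. inverse (g n * exp (- p * ln (real n))))"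
    by (intro convergent_imp_Bseq) (auto simp: convergent_def)
  then obtain C where C: "C > 0" "\<And>n. norm (inverse (g n * exp (- p * ln (real n)))) \<le> C"
    by (auto elim: BseqE)
  have le: "real n powr p \<le> C * g n" for n
  \<comment> \<open>At \<open>n = 0\<close> the left side vanishes, since
    \<open>0 powr p = 0\<close> for every \<open>p\<close>.\<close>
  proof (cases "n = 0")
    case False
    have "real n powr p = inverse (g n * exp (- p * ln (real n))) * g n"
      using False g_pos[of n] by (simp add: powr_def exp_minus field_simps)
    also have "\<dots> \<le> C * g n"
      using C(2)[of n] g_pos[of n] by (intro mult_right_mono) auto
    finally show ?thesis .
  qed (use C(1) g_pos[of 0] in simp)
  have sums: "(\<lambda>n. C * g n * r ^ n) sums (C * (1 - r) powr - (p + 1))" if "0 \<le> r" "r < 1" for r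
  proof -
    have "(- (p + 1) gchoose n) * (- r) ^ n = g n * r ^ n" for n
      unfolding g_eq by (subst power_minus) (simp flip: mult.assoc add: power_mult_distrib[symmetric])
    then have "(\<lambda>n. g n * r ^ n) sums (1 - r) powr - (p + 1)"
      using gen_binomial_real[of "- r" "- (p + 1)"] that by simp
    from sums_mult[OF this, of C] show ?thesis by (simp add: mult.assoc)
  qed
  have le': "real n powr p * r ^ n \<le> C * g n * r ^ n" if "0 \<le> r" for n r
    using le[of n] that by (intro mult_right_mono) auto
  have summ: "summable (\<lambda>n. real n powr p * r ^ n)" if "0 \<le> r" "r < 1" for r
    by (rule summable_comparison_test'[OF sums_summable[OF sums[OF that]], of 0])
       (use le' that in auto)
  have "(\<Sum>n. real n powr p * r ^ n) \<le> C * (1 - r) powr - (p + 1)" if "0 \<le> r" "r < 1" for r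
    unfolding sums_unique[OF sums[OF that]]
    by (intro suminf_le le' that summ sums_summable[OF sums])
  with C(1) summ show ?thesis by blast
qed

text \<open>For partial sums this is orthogonality of the characters on an interval of length 1.
  Absolute summability makes the partial sums converge uniformly, so the integrals converge too. The
  sign in \<open>cis\<close> is that of \<open>exp (- 2 * pi * s) ^ n\<close> on a vertical line
  \<open>s = \<sigma> + \<i> * u\<close>.\<close>

lemma Parseval_fourier_series:
  fixes c :: "nat \<Rightarrow> complex"
  assumes "summable (\<lambda>n. norm (c n))"
  shows "((\<lambda>u. (norm (\<Sum>n. c n * cis (- 2 * pi * real n * u)))\<^sup>2) has_integral
           (\<Sum>n. (norm (c n))\<^sup>2)) {-1/2..1/2}"
proof -
  define P where "P M u = (\<Sum>n<M. c n * cis (- 2 * pi * real n * u))" for M :: nat and u :: real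
  define Q where "Q u = (\<Sum>n. c n * cis (- 2 * pi * real n * u))" for u :: real
  have orth: "((\<lambda>u. cis (2 * pi * real_of_int j * u)) has_integral (if j = 0 then 1 else 0)) {-1/2..1/2}"
    for j :: int
  proof (cases "j = 0")
    case True
    then show ?thesis using has_integral_const_real[of "1::complex" "-1/2" "1/2"] by simp
  next
    case False
    let ?w = "2 * pi * real_of_int j"
    have "((\<lambda>u. cis (?w * u) / (\<i> * ?w)) has_vector_derivative cis (?w * u)) (at u within S)" for u S
      using False unfolding cis_conv_exp
      by (auto intro!: derivative_eq_intros simp: has_vector_derivative_complex_iff
           exp_eq_polar field_simps Re_divide Im_divide power2_eq_square simp flip: cis_conv_exp)
    then have "((\<lambda>u. cis (?w * u)) has_integral
        (cis (?w * (1/2)) / (\<i> * ?w) - cis (?w * (-1/2)) / (\<i> * ?w))) {-1/2..1/2}"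
      by (intro fundamental_theorem_of_calculus) auto
    moreover have "cis (?w * (1/2)) = cis (?w * (-1/2))"
      by (simp add: cis.ctr complex_eq_iff sin_integer_2pi cis.code mult.commute sin_times_pi_eq_0)
    ultimately show ?thesis using False by simp
  qed
  have fin: "((\<lambda>u. (norm (P M u))\<^sup>2) has_integral (\<Sum>n<M. (norm (c n))\<^sup>2)) {-1/2..1/2}" for M
  proof -
    have "((\<lambda>u. \<Sum>m<M. \<Sum>n<M. c m * cnj (c n) * cis (2 * pi * real_of_int (int n - int m) * u)) has_integral
          (\<Sum>m<M. \<Sum>n<M. c m * cnj (c n) * (if int n - int m = 0 then 1 else 0))) {-1/2..1/2}"
      by (intro has_integral_sum has_integral_mult_right orth) auto
    also have "(\<lambda>u. \<Sum>m<M. \<Sum>n<M. c m * cnj (c n) * cis (2 * pi * real_of_int (int n - int m) * u))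
        = (\<lambda>u. of_real ((norm (P M u))\<^sup>2))"
      unfolding complex_norm_square P_def cnj_sum sum_product
      by (intro ext sum.cong refl) (simp add: cis_cnj cis_mult algebra_simps)
    also have "(\<Sum>m<M. \<Sum>n<M. c m * cnj (c n) * (if int n - int m = 0 then 1 else 0))
        = of_real (\<Sum>n<M. (norm (c n))\<^sup>2)"
      by (simp add: complex_norm_square if_distrib sum.delta cong: if_cong del: of_real_power)
    finally show ?thesis
      by (auto dest: has_integral_Re)
  qed
  have "uniform_limit {-1/2..1/2} P Q sequentially"
    unfolding P_def Q_def by (intro Weierstrass_m_test[OF _ assms]) (simp add: norm_mult)
  \<comment> \<open>Squaring preserves uniform convergence only for bounded limits, so a bound on
    \<open>Q\<close> is supplied.\<close>
  moreover have "bounded (Q ` {-1/2..1/2})"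
  proof -
    have "norm (Q u) \<le> (\<Sum>n. norm (c n))" for u
      unfolding Q_def using summable_norm[of "\<lambda>n. c n * cis (- 2 * pi * real n * u)"] assms
      by (simp add: norm_mult)
    then show ?thesis by (auto simp: bounded_iff)
  qed
  ultimately have "uniform_limit {-1/2..1/2} (\<lambda>M u. (norm (P M u))\<^sup>2) (\<lambda>u. (norm (Q u))\<^sup>2) sequentially"
    unfolding power2_eq_square
    by (intro uniform_lim_mult uniform_limit_norm) (auto simp: bounded_iff)
  then obtain I J where IJ: "\<And>M. ((\<lambda>u. (norm (P M u))\<^sup>2) has_integral I M) {-1/2..1/2}"
    "((\<lambda>u. (norm (Q u))\<^sup>2) has_integral J) {-1/2..1/2}" "I \<longlonglongrightarrow> J"
    by (rule uniform_limit_integral) (auto simp: P_def intro!: continuous_intros)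
  have "I = (\<lambda>M. \<Sum>n<M. (norm (c n))\<^sup>2)"
    using IJ(1) fin has_integral_unique by blast
  with IJ(3) have "J = (\<Sum>n. (norm (c n))\<^sup>2)"
    using sums_unique by (auto simp: sums_def)
  with IJ(2) show ?thesis by (simp add: Q_def)
qed

text \<open>Since \<open>S 0 = 0\<close>, the series of \<open>S\<close> may be started at index 1;
  subtracting \<open>q\<close> times the same series leaves the differences
  \<open>b\<close>.\<close>

lemma sums_power_series_Abel:
  fixes b S :: "nat \<Rightarrow> 'a :: real_normed_field"
  assumes "summable (\<lambda>n. S n * q ^ n)" "S 0 = 0" "\<And>n. S (Suc n) = S n + b (Suc n)"
  shows "(\<lambda>n. b (Suc n) * q ^ Suc n) sums ((1 - q) * (\<Sum>n. S n * q ^ n))"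
proof -
  let ?P = "\<Sum>n. S n * q ^ n"
  have P: "(\<lambda>n. S n * q ^ n) sums ?P" using assms(1) by (rule summable_sums)
  then have "(\<lambda>n. S (Suc n) * q ^ Suc n) sums ?P"
    using sums_Suc_iff[of "\<lambda>n. S n * q ^ n" ?P] assms(2) by simp
  from sums_diff[OF this sums_mult[OF P, of q]] show ?thesis
    by (simp add: assms(3) algebra_simps)
qed

section \<open>The inversion \<open>s -> i / s\<close> on a vertical line close to 0\<close>

text \<open>With \<open>T = \<tau> + m\<close>, the exact solution of \<open>i / s = T\<close> is
  \<open>i / T\<close>, whose real part is \<open>Im \<tau> / |T|^2\<close>. For \<open>m\<close>
  between \<open>N\<close> and \<open>(1 + \<epsilon>) * N\<close> this is close to
  \<open>Im \<tau> / N^2\<close>, so the vertical line passes very near \<open>i / T\<close>. The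
  inversion stretches distances there by a factor of order \<open>N^2\<close>, which is why the
  window for \<open>u\<close> has width of order \<open>N^(-2)\<close>.\<close>

lemma norm_inverse_diff_lt:
  fixes \<tau> :: complex and \<delta> :: real
  assumes "Im \<tau> > 0" "\<delta> > 0" "\<delta> < 1"
  obtains \<epsilon> \<kappa> :: real where "\<epsilon> > 0" "\<kappa> > 0"
    "eventually (\<lambda>N::nat. \<forall>m u. N \<le> m \<and> real m \<le> (1 + \<epsilon>) * N \<and>
         \<bar>u - Im (\<i> / (\<tau> + of_nat m))\<bar> \<le> \<kappa> / N\<^sup>2 \<longrightarrow>
         norm (\<i> / Complex (Im \<tau> / N\<^sup>2) u - (\<tau> + of_nat m)) < \<delta> \<and>
         norm (Complex (Im \<tau> / N\<^sup>2) u) \<le> 3 / N) sequentially"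
proof -
  define y where "y = Im \<tau>"
  \<comment> \<open>The real part of \<open>s - i / T\<close> will be at most
    \<open>24 * y * \<epsilon> / N^2\<close> and the imaginary part at most
    \<open>\<kappa> / N^2\<close>. Both are made at most \<open>\<delta> / (32 * N^2)\<close>; the
    stretching factor is at most \<open>8 * N^2\<close>, which leaves
    \<open>\<delta> / 2\<close>.\<close>
  define \<epsilon> where "\<epsilon> = min (1/2) (\<delta> / (768 * y))"
  define \<kappa> where "\<kappa> = \<delta> / 32"
  have y: "y > 0" using assms by (simp add: y_def)
  have eps: "\<epsilon> > 0" "\<epsilon> \<le> 1/2" "24 * y * \<epsilon> \<le> \<delta> / 32"
    using y assms by (auto simp: \<epsilon>_def min_def field_simps)
  have kap: "\<kappa> > 0" using assms by (simp add: \<kappa>_def)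
  \<comment> \<open>Once \<open>|\<tau>| \<le> \<epsilon> * N\<close>, the modulus of
    \<open>T\<close> differs from \<open>N\<close> by at most
    \<open>2 * \<epsilon> * N\<close>.\<close>
  have "eventually (\<lambda>N::nat. real N \<ge> norm \<tau> / \<epsilon>) sequentially"
    by (intro filterlim_real_sequentially[THEN filterlim_at_top[THEN iffD1, rule_format]])
  moreover have "eventually (\<lambda>N::nat. real N \<ge> 1) sequentially"
    by (intro filterlim_real_sequentially[THEN filterlim_at_top[THEN iffD1, rule_format]])
  ultimately have "eventually (\<lambda>N::nat. \<forall>m u. N \<le> m \<and> real m \<le> (1 + \<epsilon>) * N \<and>
         \<bar>u - Im (\<i> / (\<tau> + of_nat m))\<bar> \<le> \<kappa> / N\<^sup>2 \<longrightarrow>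
         norm (\<i> / Complex (Im \<tau> / N\<^sup>2) u - (\<tau> + of_nat m)) < \<delta> \<and>
         norm (Complex (Im \<tau> / N\<^sup>2) u) \<le> 3 / N) sequentially"
  proof eventually_elim
    case (elim N)
    show ?case
    proof (intro allI impI, elim conjE)
      fix m u
      assume m: "N \<le> m" "real m \<le> (1 + \<epsilon>) * N"
        and u: "\<bar>u - Im (\<i> / (\<tau> + of_nat m))\<bar> \<le> \<kappa> / N\<^sup>2"
      define T where "T = \<tau> + of_nat m"
      define s where "s = Complex (y / N\<^sup>2) u"
      have N: "real N \<ge> 1" "norm \<tau> \<le> \<epsilon> * N" using elim eps by (auto simp: field_simps)
      have eN: "\<epsilon> * N \<le> N / 2" using eps N by (intro order.trans[OF mult_right_mono[of \<epsilon> "1/2"]]) auto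
      have mT: "\<bar>norm T - real m\<bar> \<le> norm \<tau>"
        using norm_triangle_ineq3[of T "of_nat m"] by (simp add: T_def)
      have m': "real N \<le> m" "real m \<le> N + \<epsilon> * N" using m by (auto simp: algebra_simps)
      have NT: "\<bar>norm T - N\<bar> \<le> 2 * \<epsilon> * N" using mT m N by (simp add: algebra_simps)
      have T: "norm T \<ge> N / 2" "norm T \<le> 2 * N" using mT m(1) m' N eN by linarith+
      have T0: "T \<noteq> 0" using T N by auto
      have Re_T: "Re (\<i> / T) = y / (norm T)\<^sup>2"
        by (simp add: Re_divide cmod_def T_def y_def)
      have "\<bar>(norm T)\<^sup>2 - N\<^sup>2\<bar> = \<bar>norm T - N\<bar> * (norm T + N)"
        by (simp add: power2_eq_square square_diff_square_factored abs_mult)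
      also have "\<dots> \<le> (2 * \<epsilon> * N) * (3 * N)"
        using NT T N eps by (intro mult_mono) auto
      finally have sq: "\<bar>(norm T)\<^sup>2 - N\<^sup>2\<bar> \<le> 6 * \<epsilon> * N\<^sup>2" by (simp add: power2_eq_square algebra_simps)
      have "\<bar>y / N\<^sup>2 - y / (norm T)\<^sup>2\<bar> = y * \<bar>(norm T)\<^sup>2 - N\<^sup>2\<bar> / (N\<^sup>2 * (norm T)\<^sup>2)"
      proof -
        have "y / N\<^sup>2 - y / (norm T)\<^sup>2 = y * ((norm T)\<^sup>2 - N\<^sup>2) / (N\<^sup>2 * (norm T)\<^sup>2)"
          using N T0 by (simp add: diff_frac_eq algebra_simps)
        then show ?thesis using y by (simp add: abs_mult)
      qed
      also have "\<dots> \<le> y * (6 * \<epsilon> * N\<^sup>2) / (N\<^sup>2 * (N / 2)\<^sup>2)"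
        using y N T eps sq by (intro frac_le mult_left_mono power_mono mult_nonneg_nonneg) auto
      also have "\<dots> = 24 * y * \<epsilon> / N\<^sup>2" using N by (simp add: field_simps)
      finally have 1: "\<bar>Re s - Re (\<i> / T)\<bar> \<le> (\<delta> / 32) / N\<^sup>2"
        unfolding Re_T using divide_right_mono[OF eps(3), of "real N ^ 2"] by (simp add: s_def)
      have "norm (s - \<i> / T) \<le> \<bar>Re (s - \<i> / T)\<bar> + \<bar>Im (s - \<i> / T)\<bar>" by (rule cmod_le)
      also have "\<dots> \<le> (\<delta> / 32) / N\<^sup>2 + \<kappa> / N\<^sup>2"
        using 1 u unfolding T_def by (intro add_mono) (auto simp: s_def)
      finally have sT: "norm (s - \<i> / T) \<le> \<delta> / (16 * N\<^sup>2)" by (simp add: \<kappa>_def)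
      define x where "x = 1 / real N"
      have x: "x > 0" using N by (simp add: x_def)
      have "\<delta> / (16 * N\<^sup>2) \<le> x / 16"
        using N assms by (simp add: x_def field_simps power2_eq_square)
      then have sT': "norm (s - \<i> / T) \<le> x / 16" using sT by simp
      have iT: "norm (\<i> / T) \<ge> x / 2" "norm (\<i> / T) \<le> 2 * x"
        using T N T0 by (auto simp: x_def norm_divide field_simps)
      have "norm s \<ge> x / 4" "norm s \<le> 3 * x"
        using sT' iT x norm_triangle_ineq3[of s "\<i> / T"] by linarith+
      then have s: "norm s \<ge> 1 / (4 * N)" and s2: "norm s \<le> 3 / N"
        by (simp_all add: x_def)
      have s0: "s \<noteq> 0" using s N by auto
      \<comment> \<open>The factor \<open>T / s\<close> is the stretching;
        \<open>|T| \<le> 2 * N\<close> and \<open>|s| \<ge> 1 / (4 * N)\<close> bound it by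
        \<open>8 * N^2\<close>.\<close>
      have "\<i> / s - T = (\<i> / T - s) * T / s" using s0 T0 by (simp add: field_simps)
      then have "norm (\<i> / s - T) = norm (s - \<i> / T) * norm T / norm s"
        by (simp add: norm_divide norm_mult norm_minus_commute)
      also have "\<dots> \<le> (\<delta> / (16 * N\<^sup>2)) * (2 * N) / (1 / (4 * N))"
        using sT T s N assms by (intro frac_le mult_mono) auto
      also have "\<dots> = \<delta> / 2" using N by (simp add: field_simps power2_eq_square)
      also have "\<dots> < \<delta>" using assms by simp
      finally show "norm (\<i> / Complex (Im \<tau> / N\<^sup>2) u - (\<tau> + of_nat m)) < \<delta> \<and>
         norm (Complex (Im \<tau> / N\<^sup>2) u) \<le> 3 / N"
        using s2 by (simp add: s_def T_def y_def)
    qed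
  qed
  with that[of \<epsilon> \<kappa>] eps(1) kap show thesis by blast
qed

section \<open>Series with small coefficients, and integrals over disjoint intervals\<close>

text \<open>Beyond some \<open>n0\<close> the squares are at most \<open>\<eta> * n^p\<close>, and
  the series of \<open>n^p\<close> at \<open>r = exp (- 2 * t)\<close> is of order
  \<open>t powr - (p + 1)\<close>. The finitely many earlier terms contribute at most a constant,
  which is negligible because \<open>t powr - (p + 1)\<close> tends to infinity. With
  \<open>p = k - 1/2\<close> this is the upper bound for the mean square.\<close>

lemma suminf_smallo_powr_le:
  fixes p \<epsilon> :: real and S :: "nat \<Rightarrow> 'a :: {real_normed_field,banach}"
  assumes "p > -1" "\<epsilon> > 0" "S \<in> o(\<lambda>n. of_real (real n powr (p / 2)))"
  shows "eventually (\<lambda>t. (\<Sum>n. (norm (S n) * exp (- t * real n))\<^sup>2) \<le> \<epsilon> * t powr - (p + 1)) (at_right 0)"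
proof -
  from suminf_powr_mult_power_le[OF assms(1)]
  obtain C where "C > 0" and *: "\<forall>r. 0 \<le> r \<and> r < 1 \<longrightarrow> summable (\<lambda>n. real n powr p * r ^ n) \<and>
      (\<Sum>n. real n powr p * r ^ n) \<le> C * (1 - r) powr - (p + 1)"
    by (elim exE conjE)
  note C = \<open>C > 0\<close> *[rule_format, THEN conjunct1, OF conjI] *[rule_format, THEN conjunct2, OF conjI]
  \<comment> \<open>This choice gives the tail half of the permitted \<open>\<epsilon>\<close>; the
    other half is for the initial terms.\<close>
  define \<eta> where "\<eta> = \<epsilon> / (2 * C)"
  have \<eta>: "\<eta> > 0" using assms C by (simp add: \<eta>_def)
  from landau_o.smallD[OF assms(3), of "sqrt \<eta>"] \<eta>
  obtain n0 where n0: "\<And>n. n \<ge> n0 \<Longrightarrow> norm (S n) \<le> sqrt \<eta> * real n powr (p / 2)"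
    by (auto simp: eventually_sequentially)
  define K where "K = (\<Sum>n<n0. (norm (S n))\<^sup>2)"
  have K: "K \<ge> 0" by (auto simp: K_def intro: sum_nonneg)
  have bound: "(norm (S n) * exp (- t * real n))\<^sup>2 \<le>
      (if n < n0 then (norm (S n))\<^sup>2 else 0) + \<eta> * (real n powr p * exp (- 2 * t) ^ n)"
    if "t > 0" for t n
  proof (cases "n < n0")
    case True
    have "norm (S n) * exp (- t * real n) \<le> norm (S n) * 1"
      using that by (intro mult_left_mono) auto
    then have "(norm (S n) * exp (- t * real n))\<^sup>2 \<le> (norm (S n))\<^sup>2"
      by (intro power_mono) auto
    then show ?thesis using True \<eta> by (simp add: add_increasing2)
  next
    case False
    have "(norm (S n) * exp (- t * real n))\<^sup>2 \<le> (sqrt \<eta> * real n powr (p / 2) * exp (- t * real n))\<^sup>2"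
      using n0[of n] False by (intro power_mono mult_right_mono) auto
    also have "\<dots> = \<eta> * ((real n powr (p / 2))\<^sup>2 * (exp (- t * real n))\<^sup>2)"
      using \<eta> by (simp add: power_mult_distrib)
    also have "(real n powr (p / 2))\<^sup>2 = real n powr p"
      by (simp add: power2_eq_square flip: powr_add)
    also have "(exp (- t * real n))\<^sup>2 = exp (- 2 * t) ^ n"
      by (simp add: mult_ac flip: exp_of_nat_mult exp_double)
    finally show ?thesis using False by simp
  qed
  have "((\<lambda>t::real. t powr (p + 1)) \<longlongrightarrow> 0 powr (p + 1)) (at_right 0)"
    using assms(1) by (intro tendsto_powr' tendsto_intros)
      (auto simp: eventually_at_filter intro!: always_eventually)
  \<comment> \<open>The shift to \<open>K + 1\<close> avoids division by zero when all initial terms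
    vanish.\<close>
  moreover have "0 < \<epsilon> / (2 * (K + 1))" using K assms by simp
  ultimately have "eventually (\<lambda>t. t powr (p + 1) < \<epsilon> / (2 * (K + 1))) (at_right 0)"
    by (intro order_tendstoD(2)) auto
  moreover have "eventually (\<lambda>t::real. t > 0) (at_right 0)"
    by (auto simp: eventually_at_filter)
  moreover have "eventually (\<lambda>t::real. t < 1 / 2) (at_right 0)"
    by (intro order_tendstoD[OF tendsto_ident_at]) auto
  ultimately show ?thesis
  proof eventually_elim
    case (elim t)
    define r where "r = exp (- 2 * t)"
    have r: "0 \<le> r" "r < 1" using elim by (auto simp: r_def)
    \<comment> \<open>The aim is \<open>1 - r \<ge> t\<close>, which replaces the power of
      \<open>1 - r\<close> by the same power of \<open>t\<close>; the condition
      \<open>t < 1/2\<close> enters in the next inequality.\<close>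
    have "r \<le> 1 / (1 + 2 * t)"
      using elim exp_ge_add_one_self[of "2 * t"] by (simp add: r_def exp_minus field_simps)
    also have "\<dots> \<le> 1 - t"
      using elim by (simp add: field_simps)
    finally have rt: "t \<le> 1 - r" by simp
    have sums1: "(\<lambda>n. if n < n0 then (norm (S n))\<^sup>2 else 0) sums K"
      using sums_If_finite_set[of "{..<n0}" "\<lambda>n. (norm (S n))\<^sup>2"] by (simp add: K_def)
    have sums2: "(\<lambda>n. (if n < n0 then (norm (S n))\<^sup>2 else 0) + \<eta> * (real n powr p * r ^ n))
        sums (K + \<eta> * (\<Sum>n. real n powr p * r ^ n))"
      by (intro sums_add sums1 sums_mult summable_sums C r)
    have summ: "summable (\<lambda>n. (norm (S n) * exp (- t * real n))\<^sup>2)"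
      using bound elim by (intro summable_comparison_test'[OF sums_summable[OF sums2], of 0]) (auto simp: r_def)
    have "(\<Sum>n. (norm (S n) * exp (- t * real n))\<^sup>2) \<le> K + \<eta> * (\<Sum>n. real n powr p * r ^ n)"
      unfolding sums_unique[OF sums2] using bound elim
      by (intro suminf_le summ sums_summable[OF sums2]) (auto simp: r_def)
    also have "\<eta> * (\<Sum>n. real n powr p * r ^ n) \<le> \<eta> * (C * (1 - r) powr - (p + 1))"
      using \<eta> by (intro mult_left_mono C r) auto
    also have "\<dots> \<le> \<eta> * (C * t powr - (p + 1))"
      using \<eta> C elim rt assms by (intro mult_left_mono powr_mono2') auto
    also have "\<dots> = \<epsilon> / 2 * t powr - (p + 1)" using C by (simp add: \<eta>_def)
    also have "K \<le> \<epsilon> / 2 * t powr - (p + 1)"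
    proof -
      have "K * t powr (p + 1) \<le> K * (\<epsilon> / (2 * (K + 1)))"
        using elim K by (intro mult_left_mono) auto
      also have "\<dots> \<le> \<epsilon> / 2" using K assms by (simp add: field_simps)
      finally have "K \<le> \<epsilon> / 2 / t powr (p + 1)" using elim by (subst pos_le_divide_eq) auto
      then show ?thesis by (simp only: powr_minus divide_inverse)
    qed
    finally show ?case by simp
  qed
qed

lemma summable_smallo_powr_mult_power:
  fixes p r :: real and S :: "nat \<Rightarrow> 'a :: {real_normed_field,banach}"
  assumes "p > -1" "S \<in> o(\<lambda>n. of_real (real n powr p))" "0 \<le> r" "r < 1"
  shows "summable (\<lambda>n. norm (S n) * r ^ n)"
proof -
  from landau_o.smallD[OF assms(2), of 1]
  obtain n0 where n0: "\<And>n. n \<ge> n0 \<Longrightarrow> norm (S n) \<le> real n powr p"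
    by (auto simp: eventually_sequentially)
  have "summable (\<lambda>n. real n powr p * r ^ n)"
  proof -
    from suminf_powr_mult_power_le[OF assms(1)]
    obtain C where "\<forall>r. 0 \<le> r \<and> r < 1 \<longrightarrow> summable (\<lambda>n. real n powr p * r ^ n) \<and>
        (\<Sum>n. real n powr p * r ^ n) \<le> C * (1 - r) powr - (p + 1)"
      by (elim exE conjE)
    from this[rule_format, THEN conjunct1, OF conjI, OF assms(3,4)] show ?thesis .
  qed
  moreover have "norm (norm (S n) * r ^ n) \<le> real n powr p * r ^ n" if "n \<ge> n0" for n
    using mult_right_mono[OF n0[OF that] zero_le_power[OF assms(3)]] assms(3) by simp
  ultimately show ?thesis
    by (rule summable_comparison_test')
qed

text \<open>By disjointness the sum of the step functions of height \<open>B\<close> on the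
  intervals stays below \<open>g\<close>, and each step has integral \<open>2 * h * B\<close>. This
  turns a count of peaks into a lower bound for a mean square.\<close>

lemma card_disjoint_intervals_le_integral:
  fixes g :: "real \<Rightarrow> real" and v :: "'i \<Rightarrow> real"
  assumes "(g has_integral I) {a..b}" "\<And>x. x \<in> {a..b} \<Longrightarrow> g x \<ge> 0" "finite M" "h \<ge> 0"
    and "\<And>m. m \<in> M \<Longrightarrow> {v m - h..v m + h} \<subseteq> {a..b}"
    and "disjoint_family_on (\<lambda>m. {v m - h..v m + h}) M"
    and "\<And>m x. m \<in> M \<Longrightarrow> x \<in> {v m - h..v m + h} \<Longrightarrow> g x \<ge> B"
  shows "real (card M) * (2 * h * B) \<le> I"
proof -
  let ?J = "\<lambda>m. {v m - h..v m + h}"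
  have "((\<lambda>x. \<Sum>m\<in>M. if x \<in> ?J m then B else 0) has_integral (\<Sum>m\<in>M. 2 * h * B)) {a..b}"
  proof (intro has_integral_sum assms(3))
    fix m assume "m \<in> M"
    have "((\<lambda>x. B) has_integral 2 * h * B) (?J m)"
      using has_integral_const_real[of B "v m - h" "v m + h"] assms(4) by simp
    then show "((\<lambda>x. if x \<in> ?J m then B else 0) has_integral 2 * h * B) {a..b}"
      using assms(5)[OF \<open>m \<in> M\<close>] by (subst has_integral_restrict)
  qed
  moreover have "(\<Sum>m\<in>M. if x \<in> ?J m then B else 0) \<le> g x" if "x \<in> {a..b}" for x
  proof (cases "\<exists>m\<in>M. x \<in> ?J m")
    case True
    then obtain m where m: "m \<in> M" "x \<in> ?J m" by blast
    have "x \<in> ?J m' \<longleftrightarrow> m' = m" if "m' \<in> M" for m'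
      using m that assms(6) unfolding disjoint_family_on_def by blast
    then have "(\<Sum>m'\<in>M. if x \<in> ?J m' then B else 0) = (\<Sum>m'\<in>M. if m' = m then B else 0)"
      by (intro sum.cong) auto
    also have "\<dots> = B" using m assms(3) by simp
    finally show ?thesis using assms(7)[OF m] by simp
  next
    case False
    then have "(\<Sum>m\<in>M. if x \<in> ?J m then B else 0) = 0" by (intro sum.neutral) auto
    then show ?thesis using assms(2)[OF that] by simp
  qed
  ultimately show ?thesis
    using has_integral_le[OF _ assms(1)] by fastforce
qed

section \<open>Rational points and the behaviour of cusp forms there\<close>

text \<open>Bezout's identity completes the bottom row formed by the denominator and the negated
  numerator of \<open>\<alpha>\<close> to a matrix of determinant 1. This matrix sends
  \<open>\<alpha>\<close> to the cusp at infinity.\<close>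

lemma Rats_eq_cusp:
  assumes "\<alpha> \<in> \<rat>"
  obtains a b c d :: int where "a * d - b * c = 1" "c > 0" "\<alpha> = - of_int d / of_int c"
proof -
  obtain p q :: int where pq: "q > 0" "coprime p q" "\<alpha> = of_int p / of_int q"
    using assms by (rule Rats_cases')
  obtain u v where "u * p + v * q = gcd p q" using bezout_int by blast
  then have "(- u) * (- p) - (- v) * q = 1" using pq(2) by simp
  \<comment> \<open>The instantiation follows the order of occurrence in the first conclusion:
    \<open>a\<close>, \<open>d\<close>, \<open>b\<close>, \<open>c\<close>.\<close>
  with pq show thesis by (intro that[of "-u" "-p" "-v" q]) auto
qed

lemma cusp_form_periodic:
  assumes "cusp_form k f" "Im \<tau> > 0"
  shows "f (\<tau> + of_nat m) = f \<tau>"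
proof -
  obtain g where g: "\<And>\<tau>. Im \<tau> > 0 \<Longrightarrow> f \<tau> = g (exp (2 * of_real pi * \<i> * \<tau>))"
    using assms(1) unfolding cusp_form_def upper_half_plane_def by auto
  have "exp (2 * of_real pi * \<i> * (\<tau> + of_nat m)) = exp (2 * of_real pi * \<i> * \<tau>)"
    by (intro exp_eq[THEN iffD2] exI[of _ "int m"]) (simp add: algebra_simps)
  with assms(2) g show ?thesis by simp
qed

text \<open>At \<open>\<tau> = - d / c + i * s\<close> one has
  \<open>c * \<tau> + d = i * c * s\<close>, so the base of the power is just \<open>c * s\<close>,
  and the image point is \<open>a / c - 1 / (c * (c * \<tau> + d))\<close>. The multiplier has
  modulus 1 and disappears under the norm.\<close>

lemma norm_cusp_form_at_cusp:
  fixes a b c d :: int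
  assumes "cusp_form k f" "a * d - b * c = 1" "c > 0" "Re s > 0"
  shows "norm (f (of_int a / of_int c + \<i> / (of_int c ^ 2 * s))) =
    (of_int c * norm s) powr k * norm (f (of_real (- of_int d / of_int c) + \<i> * s))"
proof -
  define \<tau> where "\<tau> = of_real (- of_int d / of_int c) + \<i> * s"
  have s: "s \<noteq> 0" using assms by auto
  have c: "(of_int c :: complex) \<noteq> 0" using assms by simp
  have det: "(of_int a * of_int d :: complex) = 1 + of_int b * of_int c"
    using assms(2) by (metis add.commute diff_add_cancel of_int_1 of_int_add of_int_mult)
  have den: "of_int c * \<tau> + of_int d = \<i> * of_int c * s"
    using c by (simp add: \<tau>_def field_simps)
  have "(of_int a * \<tau> + of_int b) / (of_int c * \<tau> + of_int d) = of_int a / of_int c + \<i> / (of_int c ^ 2 * s)"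
    unfolding den using c s det by (simp add: \<tau>_def field_simps power2_eq_square)
  moreover have "\<tau> \<in> upper_half_plane" using assms by (simp add: \<tau>_def upper_half_plane_def)
  ultimately obtain A where "norm A = 1" "f (of_int a / of_int c + \<i> / (of_int c ^ 2 * s)) =
       A * ((- \<i> * (of_int c * \<tau> + of_int d)) powr of_real k) * f \<tau>"
    using assms unfolding cusp_form_def by metis
  then show ?thesis
    unfolding den using assms(3)
    by (simp add: norm_mult norm_powr_real_powr' \<tau>_def flip: mult.assoc)
qed

section \<open>The lower bound for the mean square\<close>

lemma norm_one_minus_exp_le:
  fixes z :: complex
  assumes "norm z \<le> 1 / 2"
  shows "norm (1 - exp z) \<le> 2 * norm z"
proof -
  have "exp (norm z) \<le> 2"
    using exp_bound_lemma[of "norm z"] assms by simp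
  moreover have "norm (exp z - 1) \<le> exp (norm z) * norm z"
    using Taylor_exp_field[of z 0] by simp
  ultimately show ?thesis
    by (simp add: norm_minus_commute mult_right_mono order.trans)
qed

text \<open>At least \<open>\<epsilon> * N\<close> disjoint intervals, of length of order
  \<open>N^(-2)\<close>, each carry values of \<open>|P|^2\<close> of order at least
  \<open>N^(2 * k + 2)\<close>, which gives the exponent \<open>2 * k + 1\<close>. The growth of
  \<open>S\<close> enters only through convergence (\<open>summ\<close>) and the Abel-summed form of
  \<open>f\<close> (\<open>f_eq\<close>).\<close>

lemma mean_square_lower_bound:
  fixes S :: "nat \<Rightarrow> complex"
  assumes f: "cusp_form k f" and \<alpha>: "\<alpha> \<in> \<rat>" and \<tau>0: "Im \<tau>0 > 0" "f \<tau>0 \<noteq> 0"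
    and summ: "\<And>r. 0 \<le> r \<Longrightarrow> r < 1 \<Longrightarrow> summable (\<lambda>n. norm (S n) * r ^ n)"
    and f_eq: "\<And>s :: complex. Re s > 0 \<Longrightarrow>
      f (of_real \<alpha> + \<i> * s) = (1 - exp (- 2 * pi * s)) * (\<Sum>n. S n * exp (- 2 * pi * s) ^ n)"
  obtains K y where "K > 0" "y > 0"
    "eventually (\<lambda>N::nat. K * real N powr (2 * k + 1) \<le>
       (\<Sum>n. (norm (S n) * exp (- (y / N\<^sup>2) * real n))\<^sup>2)) sequentially"
proof -
  obtain a b c d :: int where c: "c > 0" and det: "a * d - b * c = 1"
    and \<alpha>_eq: "\<alpha> = - of_int d / of_int c"
    using \<alpha> by (rule Rats_eq_cusp)
  have k: "k > 0" using f by (simp add: cusp_form_def)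
  define \<beta> :: complex where "\<beta> = of_int a / of_int c"
  define C where "C = real_of_int c"
  have C: "C > 0" using c by (simp add: C_def)
  define \<eta> where "\<eta> = norm (f \<tau>0) / 2"
  have \<eta>: "\<eta> > 0" using \<tau>0 by (simp add: \<eta>_def)
  \<comment> \<open>Radius below 1/2 keeps the discs around different integer translates of
    \<open>\<tau>0\<close> disjoint, and hence the intervals for different \<open>m\<close>.\<close>
  obtain \<delta> where \<delta>: "\<delta> > 0" "\<delta> < 1 / 2"
    and near: "\<And>\<tau>. norm (\<tau> - \<tau>0) < \<delta> \<Longrightarrow> Im \<tau> > 0 \<and> norm (f \<tau>) \<ge> \<eta>"
  proof -
    have "open upper_half_plane"
      unfolding upper_half_plane_def by (rule open_halfspace_Im_gt)
    then have "isCont f \<tau>0"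
      using f \<tau>0 by (auto simp: cusp_form_def upper_half_plane_def continuous_on_eq_continuous_at
          dest!: holomorphic_on_imp_continuous_on)
    then have "((\<lambda>\<tau>. norm (f \<tau>)) \<longlongrightarrow> norm (f \<tau>0)) (nhds \<tau>0)"
      by (intro tendsto_norm) (simp add: isCont_def tendsto_at_iff_tendsto_nhds)
    then have "eventually (\<lambda>\<tau>. norm (f \<tau>) > \<eta>) (nhds \<tau>0)"
      using \<tau>0 by (intro order_tendstoD) (auto simp: \<eta>_def)
    moreover have "eventually (\<lambda>\<tau>. \<tau> \<in> upper_half_plane) (nhds \<tau>0)"
      using \<open>open upper_half_plane\<close> \<tau>0 by (intro eventually_nhds_in_open) (auto simp: upper_half_plane_def)
    ultimately have "eventually (\<lambda>\<tau>. Im \<tau> > 0 \<and> norm (f \<tau>) \<ge> \<eta>) (nhds \<tau>0)"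
      by eventually_elim (auto simp: upper_half_plane_def)
    then obtain d where d: "d > 0" "\<And>\<tau>. dist \<tau> \<tau>0 < d \<Longrightarrow> Im \<tau> > 0 \<and> norm (f \<tau>) \<ge> \<eta>"
      unfolding eventually_nhds_metric by blast
    show thesis
      by (rule that[of "min d (1 / 3)"]) (use d in \<open>auto simp: dist_norm\<close>)
  qed
  \<comment> \<open>Modularity leads to the point \<open>\<beta> + i / (c^2 * s)\<close>, so it is
    \<open>i / (c^2 * s)\<close> that must approach \<open>\<tau>0 - \<beta>\<close> up to an
    integer. As \<open>\<beta>\<close> is real, the imaginary part is unchanged.\<close>
  define \<tau> where "\<tau> = \<tau>0 - \<beta>"
  have Im_\<tau>: "Im \<tau> = Im \<tau>0" using c by (simp add: \<tau>_def \<beta>_def)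
  obtain \<epsilon> \<kappa> :: real where \<epsilon>: "\<epsilon> > 0" and \<kappa>: "\<kappa> > 0" and
    ev: "eventually (\<lambda>N::nat. \<forall>m u. N \<le> m \<and> real m \<le> (1 + \<epsilon>) * N \<and>
         \<bar>u - Im (\<i> / (\<tau> + of_nat m))\<bar> \<le> \<kappa> / N\<^sup>2 \<longrightarrow>
         norm (\<i> / Complex (Im \<tau> / N\<^sup>2) u - (\<tau> + of_nat m)) < \<delta> \<and>
         norm (Complex (Im \<tau> / N\<^sup>2) u) \<le> 3 / N) sequentially"
    by (rule norm_inverse_diff_lt[of \<tau> \<delta>]) (use \<tau>0 \<delta> Im_\<tau> in auto)
  \<comment> \<open>Solving
    \<open>\<eta> \<le> (3 / (C * N))^k * (12 * pi / (C^2 * N)) * |P|\<close> for \<open>|P|\<close>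
    gives the bound \<open>K1 * N^(k + 1)\<close>. The constant \<open>K\<close> combines its square
    with \<open>\<epsilon> * N\<close> intervals of length
    \<open>2 * \<kappa> / (C^2 * N^2)\<close>.\<close>
  define K1 where "K1 = \<eta> * (3 / C) powr - k * (C\<^sup>2 / (12 * pi))"
  have K1: "K1 > 0" using \<eta> C by (simp add: K1_def)
  define K where "K = 2 * \<epsilon> * \<kappa> / C\<^sup>2 * K1\<^sup>2"
  \<comment> \<open>The factor \<open>2 * pi\<close> is included so that
    \<open>y / N^2 = 2 * pi * \<sigma>\<close>, the decay rate of \<open>|q|^n\<close> on the line
    \<open>Re s = \<sigma>\<close>.\<close>
  define y where "y = 2 * pi * (Im \<tau> / C\<^sup>2)"
  have "K > 0" "y > 0" using K1 \<epsilon> \<kappa> C \<tau>0 Im_\<tau> by (auto simp: K_def y_def)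
  moreover have "eventually (\<lambda>N::nat. K * real N powr (2 * k + 1) \<le>
       (\<Sum>n. (norm (S n) * exp (- (y / N\<^sup>2) * real n))\<^sup>2)) sequentially"
  proof -
    \<comment> \<open>This makes \<open>|s| \<le> 3 / (C^2 * N) \<le> 1 / (4 * pi)\<close>, which
      keeps the intervals inside the period \<open>[-1/2, 1/2]\<close> and makes
      \<open>2 * pi * |s| \<le> 1/2\<close>, as needed to estimate \<open>1 - q\<close>.\<close>
    have "eventually (\<lambda>N::nat. real N \<ge> max 1 (12 * pi / C\<^sup>2)) sequentially"
      by (intro filterlim_real_sequentially[THEN filterlim_at_top[THEN iffD1, rule_format]])
    with ev show ?thesis
    proof eventually_elim
      case (elim N)
      have N: "real N \<ge> 1" "real N \<ge> 12 * pi / C\<^sup>2" using elim(2) by auto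
      define \<sigma> where "\<sigma> = Im \<tau> / N\<^sup>2 / C\<^sup>2"
      have \<sigma>: "\<sigma> > 0" using N \<tau>0 Im_\<tau> C by (simp add: \<sigma>_def)
      define M where "M = {m. N \<le> m \<and> real m \<le> (1 + \<epsilon>) * N}"
      \<comment> \<open>The centre is the imaginary part of the solution \<open>s\<close> of
        \<open>i / (c^2 * s) = \<tau> + m\<close>. The inversion estimate is applied to
        \<open>C^2 * s\<close>, so centre, half-width \<open>h\<close> and \<open>\<sigma>\<close>
        are all divided by \<open>C^2\<close>.\<close>
      define v where "v m = Im (\<i> / (\<tau> + of_nat m)) / C\<^sup>2" for m :: nat
      define h where "h = \<kappa> / N\<^sup>2 / C\<^sup>2"
      define P where "P u = (\<Sum>n. S n * exp (- 2 * pi * Complex \<sigma> u) ^ n)" for u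
      have M_eq: "M = {N..N + nat \<lfloor>\<epsilon> * N\<rfloor>}"
      proof (intro set_eqI iffI)
        fix m assume "m \<in> M"
        then have m: "N \<le> m" "real (m - N) \<le> \<epsilon> * N" by (auto simp: M_def algebra_simps of_nat_diff)
        then show "m \<in> {N..N + nat \<lfloor>\<epsilon> * N\<rfloor>}" using le_nat_floor[OF m(2)] by auto
      next
        fix m assume m: "m \<in> {N..N + nat \<lfloor>\<epsilon> * N\<rfloor>}"
        then have "real m \<le> N + real (nat \<lfloor>\<epsilon> * N\<rfloor>)" by (simp flip: of_nat_add)
        also have "real (nat \<lfloor>\<epsilon> * N\<rfloor>) \<le> \<epsilon> * N" using \<epsilon> by (intro of_nat_floor) simp
        finally show "m \<in> M" using m by (simp add: M_def algebra_simps)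
      qed
      have "finite M" unfolding M_eq by simp
      \<comment> \<open>Both endpoints belong to \<open>M\<close>; the extra element makes up for
        rounding down.\<close>
      have card_M: "real (card M) \<ge> \<epsilon> * N"
        unfolding M_eq using \<epsilon> by simp linarith
      have J: "norm (\<i> / (of_int c ^ 2 * Complex \<sigma> u) - (\<tau> + of_nat m)) < \<delta> \<and>
               norm (Complex \<sigma> u) \<le> 3 / (C\<^sup>2 * N)"
        if "m \<in> M" "u \<in> {v m - h..v m + h}" for m u
      proof -
        have "\<bar>C\<^sup>2 * u - Im (\<i> / (\<tau> + of_nat m))\<bar> = \<bar>C\<^sup>2 * (u - v m)\<bar>"
          using C by (simp add: v_def algebra_simps)
        also have "\<dots> = C\<^sup>2 * \<bar>u - v m\<bar>" by (simp add: abs_mult)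
        also have "\<dots> \<le> C\<^sup>2 * h" using that by (intro mult_left_mono) (auto simp: abs_le_iff)
        also have "\<dots> = \<kappa> / N\<^sup>2" using C by (simp add: h_def)
        finally have "\<bar>C\<^sup>2 * u - Im (\<i> / (\<tau> + of_nat m))\<bar> \<le> \<kappa> / N\<^sup>2" .
        with elim(1) that(1) have
          *: "norm (\<i> / Complex (Im \<tau> / N\<^sup>2) (C\<^sup>2 * u) - (\<tau> + of_nat m)) < \<delta>"
             "norm (Complex (Im \<tau> / N\<^sup>2) (C\<^sup>2 * u)) \<le> 3 / N"
          unfolding M_def by auto
        have eq: "Complex (Im \<tau> / N\<^sup>2) (C\<^sup>2 * u) = of_real (C\<^sup>2) * Complex \<sigma> u"
          using C by (simp add: complex_eq_iff \<sigma>_def)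
        have "norm (Complex \<sigma> u) \<le> 3 / (C\<^sup>2 * N)"
          using *(2) C N unfolding eq norm_mult norm_of_real by (simp add: field_simps)
        with *(1) show ?thesis unfolding eq by (simp add: C_def)
      qed
      have small: "3 / (C\<^sup>2 * N) \<le> 1 / (4 * pi)"
        using N C by (simp add: field_simps)
      have "((\<lambda>u. (norm (\<Sum>n. (S n * exp (- 2 * pi * \<sigma>) ^ n) * cis (- 2 * pi * real n * u)))\<^sup>2) has_integral
           (\<Sum>n. (norm (S n * exp (- 2 * pi * \<sigma>) ^ n))\<^sup>2)) {-1/2..1/2}"
        using summ[of "exp (- 2 * pi * \<sigma>)"] \<sigma>
        by (intro Parseval_fourier_series) (simp add: norm_mult norm_power)
      also have "(\<lambda>u. (norm (\<Sum>n. (S n * exp (- 2 * pi * \<sigma>) ^ n) * cis (- 2 * pi * real n * u)))\<^sup>2)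
          = (\<lambda>u. (norm (P u))\<^sup>2)"
      proof -
        have "(S n * exp (- 2 * pi * \<sigma>) ^ n) * cis (- 2 * pi * real n * u) =
              S n * exp (- 2 * pi * Complex \<sigma> u) ^ n" for n u
        proof -
          have "- 2 * pi * Complex \<sigma> u = Complex (- 2 * pi * \<sigma>) (- 2 * pi * u)"
            by (simp add: complex_eq_iff)
          moreover have "exp (Complex (- 2 * pi * \<sigma>) (- 2 * pi * u)) = exp (- 2 * pi * \<sigma>) * cis (- 2 * pi * u)"
            by (subst exp_eq_polar) simp
          ultimately have "exp (- 2 * pi * Complex \<sigma> u) ^ n = (exp (- 2 * pi * \<sigma>) * cis (- 2 * pi * u)) ^ n"
            by (simp only:)
          also have "\<dots> = exp (- 2 * pi * \<sigma>) ^ n * cis (- 2 * pi * real n * u)"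
            by (simp add: power_mult_distrib Complex.DeMoivre mult_ac)
          finally show ?thesis by simp
        qed
        then show ?thesis by (simp only: P_def)
      qed
      also have "(\<Sum>n. (norm (S n * exp (- 2 * pi * \<sigma>) ^ n))\<^sup>2) =
          (\<Sum>n. (norm (S n) * exp (- (y / N\<^sup>2) * real n))\<^sup>2)"
        by (simp add: norm_mult norm_power \<sigma>_def y_def flip: exp_of_nat_mult) (simp add: field_simps)
      finally have "real (card M) * (2 * h * (K1 * N powr (k + 1))\<^sup>2) \<le>
          (\<Sum>n. (norm (S n) * exp (- (y / N\<^sup>2) * real n))\<^sup>2)"
      proof (rule card_disjoint_intervals_le_integral[where v = v])
        show "{v m - h..v m + h} \<subseteq> {-1/2..1/2}" if "m \<in> M" for m
        proof
          fix u assume "u \<in> {v m - h..v m + h}"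
          then have "norm (Complex \<sigma> u) \<le> 1 / (4 * pi)" using J that small by force
          then have "\<bar>u\<bar> \<le> 1 / (4 * pi)" using abs_Im_le_cmod[of "Complex \<sigma> u"] by simp
          also have "\<dots> \<le> 1 / 2" using pi_gt3 by (simp add: field_simps)
          finally show "u \<in> {-1/2..1/2}" by auto
        qed
        show "disjoint_family_on (\<lambda>m. {v m - h..v m + h}) M"
          unfolding disjoint_family_on_def
        proof (intro ballI impI, rule ccontr)
          fix m n assume mn: "m \<in> M" "n \<in> M" "m \<noteq> n" "{v m - h..v m + h} \<inter> {v n - h..v n + h} \<noteq> {}"
          then obtain u where u: "u \<in> {v m - h..v m + h}" "u \<in> {v n - h..v n + h}" by blast
          let ?w = "\<i> / (of_int c ^ 2 * Complex \<sigma> u)"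
          have "norm (of_nat n - of_nat m :: complex) \<le> norm (?w - (\<tau> + of_nat m)) + norm (?w - (\<tau> + of_nat n))"
            using norm_triangle_ineq4[of "?w - (\<tau> + of_nat m)" "?w - (\<tau> + of_nat n)"] by simp
          also have "\<dots> < \<delta> + \<delta>" using J mn u by (intro add_strict_mono) auto
          also have "\<dots> < 1" using \<delta> by simp
          finally have "norm (of_int (int n - int m) :: complex) < 1" by simp
          then have "\<bar>int n - int m\<bar> < 1" unfolding norm_of_int by linarith
          with mn show False by simp
        qed
        fix m u assume mu: "m \<in> M" "u \<in> {v m - h..v m + h}"
        define s where "s = Complex \<sigma> u"
        define w where "w = \<i> / (of_int c ^ 2 * s)"
        have s: "Re s > 0" "s \<noteq> 0" using \<sigma> by (auto simp: s_def complex_eq_iff)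
        have Jw: "norm (w - (\<tau> + of_nat m)) < \<delta>" and Js: "norm s \<le> 3 / (C\<^sup>2 * N)"
          using J[OF mu] by (auto simp: w_def s_def)
        \<comment> \<open>Translating back by \<open>m\<close> lands in the disc around
          \<open>\<tau>0\<close>, where \<open>|f| \<ge> \<eta>\<close>; periodicity carries this
          bound to \<open>\<beta> + w\<close>.\<close>
        define \<tau>' where "\<tau>' = \<beta> + w - of_nat m"
        have "norm (\<tau>' - \<tau>0) < \<delta>" using Jw by (simp add: \<tau>'_def \<tau>_def algebra_simps)
        with near have \<tau>': "Im \<tau>' > 0" "norm (f \<tau>') \<ge> \<eta>" by auto
        have "norm (f (\<beta> + w)) = norm (f \<tau>')"
          using cusp_form_periodic[OF f \<tau>'(1), of m] by (simp add: \<tau>'_def)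
        with \<tau>' have "\<eta> \<le> norm (f (\<beta> + w))" by simp
        also have "\<dots> = (C * norm s) powr k * norm (f (of_real \<alpha> + \<i> * s))"
          using norm_cusp_form_at_cusp[OF f det c s(1)] by (simp add: \<beta>_def w_def \<alpha>_eq C_def)
        also have "\<dots> \<le> (3 / (C * N)) powr k * norm (f (of_real \<alpha> + \<i> * s))"
        proof -
          have "C * norm s \<le> C * (3 / (C\<^sup>2 * N))" using Js C by (intro mult_left_mono) auto
          also have "\<dots> = 3 / (C * N)" using C by (simp add: power2_eq_square)
          finally show ?thesis using C k by (intro mult_right_mono powr_mono2) auto
        qed
        also have "norm (f (of_real \<alpha> + \<i> * s)) = norm (1 - exp (- 2 * pi * s)) * norm (P u)"
          by (simp only: f_eq[OF s(1)] norm_mult P_def flip: s_def)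
        also have "norm (1 - exp (- 2 * pi * s)) \<le> 12 * pi / (C\<^sup>2 * N)"
        proof -
          have eq: "norm (- 2 * pi * s) = 2 * pi * norm s" by (simp add: norm_mult)
          have "norm s \<le> 1 / (4 * pi)" using Js small by linarith
          then have "norm (- 2 * pi * s) \<le> 1 / 2" unfolding eq by (simp add: field_simps)
          then have "norm (1 - exp (- 2 * pi * s)) \<le> 2 * (2 * pi * norm s)"
            using norm_one_minus_exp_le[of "- 2 * pi * s"] eq by simp
          also have "\<dots> \<le> 2 * (2 * pi * (3 / (C\<^sup>2 * N)))" using Js by (intro mult_left_mono) auto
          finally show ?thesis by simp
        qed
        finally have "\<eta> \<le> (3 / (C * N)) powr k * (12 * pi / (C\<^sup>2 * N) * norm (P u))"
          by (simp add: mult_left_mono mult_right_mono)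
        also have "\<dots> = \<eta> / (K1 * N powr (k + 1)) * norm (P u)"
        proof -
          have "(3 / (C * N)) powr k = (3 / C) powr k / N powr k"
            using C N by (simp add: powr_divide powr_mult)
          then show ?thesis using \<eta> C N by (simp add: K1_def powr_minus powr_add field_simps)
        qed
        finally have "K1 * N powr (k + 1) \<le> norm (P u)"
          using \<eta> K1 N by (simp add: field_simps)
        then show "(K1 * N powr (k + 1))\<^sup>2 \<le> (norm (P u))\<^sup>2"
          using K1 by (intro power_mono) auto
      qed (use \<open>finite M\<close> \<kappa> in \<open>auto simp: h_def\<close>)
      moreover have "K * real N powr (2 * k + 1) = (\<epsilon> * N) * (2 * h * (K1 * N powr (k + 1))\<^sup>2)"
      proof -
        have "(N powr (k + 1))\<^sup>2 = N powr (2 * k + 1) * N"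
          using N by (simp add: power2_eq_square powr_add[symmetric] powr_mult_base algebra_simps)
        then show ?thesis using N C by (simp add: K_def h_def power_mult_distrib field_simps power2_eq_square)
      qed
      moreover have "\<dots> \<le> real (card M) * (2 * h * (K1 * N powr (k + 1))\<^sup>2)"
        using card_M \<kappa> by (intro mult_right_mono) (auto simp: h_def)
      ultimately show ?case by simp
    qed
  qed
  ultimately show thesis by (rule that)
qed

section \<open>Comparison of the upper and lower bounds\<close>

theorem theorem1p1:
  fixes k \<alpha> :: real and f :: "complex \<Rightarrow> complex" and a :: "nat \<Rightarrow> complex"
  assumes "k > 0"
    and "cusp_form k f"
    and "fourier_expansion f a"
    and "\<exists>n\<ge>1. a n \<noteq> 0"
    and "\<alpha> \<in> \<rat>"
  shows "(\<lambda>x. exp_sum a x \<alpha>) \<notin> o[at_top](\<lambda>x. complex_of_real (x powr (k / 2 - 1 / 4)))"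
proof
  assume small: "(\<lambda>x. exp_sum a x \<alpha>) \<in> o[at_top](\<lambda>x. complex_of_real (x powr (k / 2 - 1 / 4)))"
  define S where "S n = exp_sum a (real n) \<alpha>" for n
  define b where "b n = a n * exp (2 * of_real pi * \<i> * of_nat n * of_real \<alpha>)" for n
  \<comment> \<open>Only integer values of \<open>x\<close> are used from here on.\<close>
  have S_small: "S \<in> o(\<lambda>n. of_real (real n powr (k / 2 - 1 / 4)))"
    unfolding S_def using landau_o.small.compose[OF small filterlim_real_sequentially] .
  have S_0: "S 0 = 0" by (auto simp: S_def exp_sum_def intro: sum.neutral)
  have S_Suc: "S (Suc n) = S n + b (Suc n)" for n
  proof -
    have "S n = sum b {1..n}" for n
      unfolding S_def exp_sum_def b_def by (intro sum.cong) auto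
    then show ?thesis by simp
  qed
  have summ: "summable (\<lambda>n. norm (S n) * r ^ n)" if "0 \<le> r" "r < 1" for r
    using S_small assms(1) that by (intro summable_smallo_powr_mult_power[of "k / 2 - 1 / 4"]) auto
  have f_eq: "f (of_real \<alpha> + \<i> * s) = (1 - exp (- 2 * pi * s)) * (\<Sum>n. S n * exp (- 2 * pi * s) ^ n)"
    if "Re s > 0" for s :: complex
  proof -
    define q where "q = exp (- 2 * pi * s)"
    have "norm q < 1" using that by (simp add: q_def)
    then have "summable (\<lambda>n. S n * q ^ n)"
      using summ[of "norm q"] by (simp add: summable_norm_cancel norm_mult norm_power)
    then have sums: "(\<lambda>n. b (Suc n) * q ^ Suc n) sums ((1 - q) * (\<Sum>n. S n * q ^ n))"
      by (rule sums_power_series_Abel[OF _ S_0 S_Suc])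
    have term_eq: "b n * q ^ n = a n * exp (2 * of_real pi * \<i> * of_nat n * (of_real \<alpha> + \<i> * s))" for n
    proof -
      have "q ^ n = exp (of_nat n * (- 2 * pi * s))" unfolding q_def by (simp only: exp_of_nat_mult)
      then have "b n * q ^ n = a n * exp (2 * of_real pi * \<i> * of_nat n * of_real \<alpha> + of_nat n * (- 2 * pi * s))"
        unfolding b_def exp_add by (simp only: mult.assoc)
      also have "2 * of_real pi * \<i> * of_nat n * of_real \<alpha> + of_nat n * (- 2 * pi * s) =
          2 * of_real pi * \<i> * of_nat n * (of_real \<alpha> + \<i> * s)"
        by (simp add: algebra_simps)
      finally show ?thesis .
    qed
    have "of_real \<alpha> + \<i> * s \<in> upper_half_plane"
      using that by (simp add: upper_half_plane_def)
    then have "(\<lambda>n. b (Suc n) * q ^ Suc n) sums f (of_real \<alpha> + \<i> * s)"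
      using assms(3) unfolding fourier_expansion_def term_eq by blast
    from sums_unique2[OF this sums] show ?thesis
      unfolding q_def .
  qed
  \<comment> \<open>A point with \<open>f \<tau>0 \<noteq> 0\<close> is found through the power
    series of \<open>S\<close>: it is not the zero series, as its coefficients have a nonzero
    difference, so it has no zeros in a small punctured disc. A real \<open>x\<close> in that disc
    gives \<open>\<tau>0\<close> above \<open>\<alpha>\<close>.\<close>
  obtain m where m: "m > 0" "S m \<noteq> 0"
  proof -
    obtain n where "a (Suc n) \<noteq> 0" using assms(4) by (metis Suc_le_D One_nat_def)
    then have "b (Suc n) \<noteq> 0" by (simp add: b_def)
    then have "S n \<noteq> 0 \<or> S (Suc n) \<noteq> 0" by (auto simp: S_Suc)
    then show thesis using that S_0 by (metis neq0_conv)
  qed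
  obtain s where s: "s > 0" "\<And>z. z \<in> cball 0 s - {0} \<Longrightarrow> (\<Sum>n. S n * z ^ n) \<noteq> 0"
  proof (rule powser_0_nonzero[of 1 0 S "\<lambda>z. \<Sum>n. S n * z ^ n" m])
    fix z :: complex assume "norm (z - 0) < 1"
    then have "summable (\<lambda>n. S n * z ^ n)"
      using summ[of "norm z"] by (simp add: summable_norm_cancel norm_mult norm_power)
    then show "(\<lambda>n. S n * (z - 0) ^ n) sums (\<Sum>n. S n * z ^ n)" by (simp add: summable_sums)
  qed (use m S_0 in auto)
  \<comment> \<open>Staying below 1 makes \<open>\<sigma>\<close> positive and the factor
    \<open>1 - x\<close> nonzero.\<close>
  define x where "x = min s (1 / 2)"
  have x: "x > 0" "x < 1" "x \<le> s" using s(1) by (auto simp: x_def)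
  define \<sigma> where "\<sigma> = - ln x / (2 * pi)"
  have "\<sigma> > 0" using x by (simp add: \<sigma>_def divide_neg_pos)
  have "- 2 * pi * \<sigma> = ln x" by (simp add: \<sigma>_def)
  then have "exp (- 2 * pi * complex_of_real \<sigma>) = exp (complex_of_real (ln x))"
    by (metis of_real_mult)
  then have q: "exp (- 2 * pi * complex_of_real \<sigma>) = of_real x"
    using x by (simp add: exp_of_real)
  define \<tau>0 where "\<tau>0 = of_real \<alpha> + \<i> * of_real \<sigma>"
  have "f \<tau>0 = (1 - of_real x) * (\<Sum>n. S n * of_real x ^ n)"
    using f_eq[of "of_real \<sigma>"] \<open>\<sigma> > 0\<close> unfolding \<tau>0_def q by simp
  moreover have "(1 - of_real x :: complex) \<noteq> 0"
    using x by simp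
  moreover have "(\<Sum>n. S n * of_real x ^ n) \<noteq> 0"
    using x by (intro s(2)) auto
  ultimately have \<tau>0: "Im \<tau>0 > 0" "f \<tau>0 \<noteq> 0"
    using \<open>\<sigma> > 0\<close> by (auto simp: \<tau>0_def)
  obtain K y where K: "K > 0" and y: "y > 0" and lower:
    "eventually (\<lambda>N::nat. K * real N powr (2 * k + 1) \<le>
       (\<Sum>n. (norm (S n) * exp (- (y / N\<^sup>2) * real n))\<^sup>2)) sequentially"
    using mean_square_lower_bound[OF assms(2,5) \<tau>0 summ f_eq] by blast
  \<comment> \<open>At \<open>t = y / N^2\<close> the upper bound then becomes exactly half of the
    lower bound \<open>K * N powr (2 * k + 1)\<close>.\<close>
  define \<epsilon> where "\<epsilon> = K / 2 * y powr (k + 1 / 2)"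
  have \<epsilon>: "\<epsilon> > 0" using K y by (simp add: \<epsilon>_def)
  have "eventually (\<lambda>t. (\<Sum>n. (norm (S n) * exp (- t * real n))\<^sup>2) \<le> \<epsilon> * t powr - (k - 1 / 2 + 1)) (at_right 0)"
    using assms(1) \<epsilon> S_small by (intro suminf_smallo_powr_le) (auto simp: diff_divide_distrib)
  moreover have "filterlim (\<lambda>N::nat. y / N\<^sup>2) (at_right 0) sequentially"
  proof -
    have "(\<lambda>N::nat. y * (inverse (real N))\<^sup>2) \<longlonglongrightarrow> y * 0\<^sup>2"
      by (intro tendsto_intros lim_inverse_n)
    then have "(\<lambda>N::nat. y / N\<^sup>2) \<longlonglongrightarrow> 0" by (simp add: field_simps)
    moreover have "eventually (\<lambda>N::nat. y / N\<^sup>2 \<in> {0<..} \<and> y / N\<^sup>2 \<noteq> 0) sequentially"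
      using eventually_gt_at_top[of "0::nat"] by eventually_elim (use y in simp)
    ultimately show ?thesis unfolding filterlim_at by blast
  qed
  ultimately have "eventually (\<lambda>N::nat. (\<Sum>n. (norm (S n) * exp (- (y / N\<^sup>2) * real n))\<^sup>2)
      \<le> \<epsilon> * (y / N\<^sup>2) powr - (k - 1 / 2 + 1)) sequentially"
    by (rule eventually_compose_filterlim)
  with lower eventually_gt_at_top[of "0::nat"] have "eventually (\<lambda>N::nat. False) sequentially"
  proof eventually_elim
    case (elim N)
    have eq: "(y / N\<^sup>2) powr - (k - 1 / 2 + 1) = y powr - (k + 1 / 2) * real N powr (2 * k + 1)"
    proof -
      have "(y / N\<^sup>2) powr - (k - 1 / 2 + 1) = y powr - (k + 1 / 2) / (real N powr 2) powr - (k + 1 / 2)"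
        using y elim(2) by (simp add: powr_divide algebra_simps)
      also have "(real N powr 2) powr - (k + 1 / 2) = inverse (real N powr (2 * k + 1))"
      proof -
        have "2 * (k + 1 / 2) = 2 * k + 1" by simp
        then show ?thesis by (simp only: powr_powr powr_minus mult_minus_right)
      qed
      finally show ?thesis by (simp only: divide_inverse inverse_inverse_eq)
    qed
    have "\<epsilon> * (y / N\<^sup>2) powr - (k - 1 / 2 + 1) =
        K / 2 * (y powr (k + 1 / 2) * y powr - (k + 1 / 2)) * real N powr (2 * k + 1)"
      unfolding eq \<epsilon>_def by (simp only: mult.assoc)
    also have "y powr (k + 1 / 2) * y powr - (k + 1 / 2) = 1"
      using y unfolding powr_minus by simp
    finally have "\<epsilon> * (y / N\<^sup>2) powr - (k - 1 / 2 + 1) = K / 2 * real N powr (2 * k + 1)" by simp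
    moreover have "K / 2 * real N powr (2 * k + 1) < K * real N powr (2 * k + 1)"
      using K elim by simp
    ultimately show False using elim unfolding of_nat_power by linarith
  qed
  then show False by simp
qed

end
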